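(* Let $\mathbb{F}$ be an algebraically closed field with $\mathrm{Char}(\mathbb{F})\ne2$. Let $a_0,a_1,a_2,x_1,x_2,\theta^*_0,\theta^*_1,\theta^*_2\in\mathbb{F}$ and consider the matrices in $\mathrm{Mat}_3(\mathbb{F})$ $$A=\begin{pmatrix}a_0&x_1&0\\1&a_1&x_2\\0&1&a_2\end{pmatrix},\qquad B=\begin{pmatrix}0&x_1&0\\1&0&x_2\\0&1&0\end{pmatrix},\qquad A^*=\mathrm{diag}(\theta^*_0,\theta^*_1,\theta^*_2).$$ Assume that $A,A^*$ is a Leonard pair over $\mathbb{F}$. Then the pair $A,A^*$ is near-bipartite if and only if $$\frac{x_1}{\theta^*_1-\theta^*_2}=\frac{x_2}{\theta^*_0-\theta^*_1}.$$ In this case, $B,A^*$ is the bipartite contraction of $A,A^*$.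
   Context: A tridiagonal matrix is irreducible if all its subdiagonal and superdiagonal entries are nonzero. Let $V$ be a vector space over $\mathbb{F}$ of dimension $d+1$. A Leonard pair on $V$ (over $\mathbb{F}$) is an ordered pair $A,A^*$ in $\mathrm{End}(V)$ such that (a) some basis of $V$ makes the matrix of $A$ irreducible tridiagonal and that of $A^*$ diagonal; (b) some basis of $V$ makes the matrix of $A^*$ irreducible tridiagonal and that of $A$ diagonal. ($A^*$ is just a name, not an adjoint.) Here $V=\mathbb{F}^3$ and matrices act by left multiplication. Each of $A,A^*$ has $d+1$ distinct eigenvalues. Let $E^*_0,\dots,E^*_d$ be the primitive idempotents of $A^*$ (projections onto its eigenspaces along the sum of the other eigenspaces). The flat part of $A$ is $F=\sum_{i=0}^d E^*_i A E^*_i$. $A,A^*$ is near-bipartite if $A-F,A^*$ is a Leonard pair on $V$; in that case $A-F,A^*$ is called the bipartite contraction of $A,A^*$. *)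

theory Defs
  imports
    "HOL-Analysis.Analysis"
    "HOL-Computational_Algebra.Computational_Algebra"
begin

text \<open>Matrices of size \<open>d + 1\<close> are functions \<open>nat \<Rightarrow> nat \<Rightarrow> 'a\<close> of which only the entries with
  both indices in \<open>{..d}\<close> matter.\<close>

definition diagonal_mat :: "nat \<Rightarrow> (nat \<Rightarrow> nat \<Rightarrow> 'a::zero) \<Rightarrow> bool" where
  "diagonal_mat d M \<longleftrightarrow> (\<forall>i\<le>d. \<forall>j\<le>d. i \<noteq> j \<longrightarrow> M i j = 0)"

definition tridiagonal_mat :: "nat \<Rightarrow> (nat \<Rightarrow> nat \<Rightarrow> 'a::zero) \<Rightarrow> bool" where
  "tridiagonal_mat d M \<longleftrightarrow>
     (\<forall>i\<le>d. \<forall>j\<le>d. M i j \<noteq> 0 \<longrightarrow> i = j \<or> i = Suc j \<or> j = Suc i)"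

definition irreducible_tridiagonal_mat :: "nat \<Rightarrow> (nat \<Rightarrow> nat \<Rightarrow> 'a::zero) \<Rightarrow> bool" where
  "irreducible_tridiagonal_mat d M \<longleftrightarrow>
     tridiagonal_mat d M \<and> (\<forall>i<d. M (Suc i) i \<noteq> 0 \<and> M i (Suc i) \<noteq> 0)"

text \<open>In what follows \<open>smul\<close> is the scalar multiplication of a vector space with underlying type
  \<open>'v\<close>.\<close>

definition ordered_basis :: "('a::field \<Rightarrow> 'v::ab_group_add \<Rightarrow> 'v) \<Rightarrow> nat \<Rightarrow> (nat \<Rightarrow> 'v) \<Rightarrow> bool" where
  "ordered_basis smul d v \<longleftrightarrow>
     inj_on v {..d} \<and> \<not> module.dependent smul (v ` {..d}) \<and> module.span smul (v ` {..d}) = UNIV"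

text \<open>Column convention: \<open>T (v j) = (\<Sum>i\<le>d. smul (matrix_wrt smul d v T i j) (v i))\<close> for
  \<open>j \<le> d\<close> whenever \<open>v\<close> is an ordered basis.\<close>

definition matrix_wrt ::
  "('a::field \<Rightarrow> 'v::ab_group_add \<Rightarrow> 'v) \<Rightarrow> nat \<Rightarrow> (nat \<Rightarrow> 'v) \<Rightarrow> ('v \<Rightarrow> 'v) \<Rightarrow> nat \<Rightarrow> nat \<Rightarrow> 'a" where
  "matrix_wrt smul d v T i j = module.representation smul (v ` {..d}) (T (v j)) (v i)"

text \<open>The existence of an ordered basis forces the space to have dimension \<open>d + 1\<close>.\<close>

definition leonard_pair ::
  "('a::field \<Rightarrow> 'v::ab_group_add \<Rightarrow> 'v) \<Rightarrow> nat \<Rightarrow> ('v \<Rightarrow> 'v) \<Rightarrow> ('v \<Rightarrow> 'v) \<Rightarrow> bool" where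
  "leonard_pair smul d A As \<longleftrightarrow>
     Vector_Spaces.linear smul smul A \<and> Vector_Spaces.linear smul smul As \<and>
     (\<exists>v. ordered_basis smul d v \<and>
          irreducible_tridiagonal_mat d (matrix_wrt smul d v A) \<and>
          diagonal_mat d (matrix_wrt smul d v As)) \<and>
     (\<exists>v. ordered_basis smul d v \<and>
          irreducible_tridiagonal_mat d (matrix_wrt smul d v As) \<and>
          diagonal_mat d (matrix_wrt smul d v A))"

definition eigenspace ::
  "('a::field \<Rightarrow> 'v::ab_group_add \<Rightarrow> 'v) \<Rightarrow> ('v \<Rightarrow> 'v) \<Rightarrow> 'a \<Rightarrow> 'v set" where
  "eigenspace smul T \<theta> = {v. T v = smul \<theta> v}"

definition eigenvalues :: "('a::field \<Rightarrow> 'v::ab_group_add \<Rightarrow> 'v) \<Rightarrow> ('v \<Rightarrow> 'v) \<Rightarrow> 'a set" where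
  "eigenvalues smul T = {\<theta>. \<exists>v\<in>eigenspace smul T \<theta>. v \<noteq> 0}"

text \<open>The projection onto the \<open>\<theta>\<close>-eigenspace of \<open>T\<close> along the sum of the other eigenspaces. It is
  uniquely determined if \<open>T\<close> is diagonalizable, and unspecified otherwise.\<close>

definition primitive_idempotent ::
  "('a::field \<Rightarrow> 'v::ab_group_add \<Rightarrow> 'v) \<Rightarrow> ('v \<Rightarrow> 'v) \<Rightarrow> 'a \<Rightarrow> 'v \<Rightarrow> 'v" where
  "primitive_idempotent smul T \<theta> =
     (THE E. Vector_Spaces.linear smul smul E \<and>
        (\<forall>v\<in>eigenspace smul T \<theta>. E v = v) \<and>
        (\<forall>v\<in>module.span smul (\<Union>\<mu>\<in>eigenvalues smul T - {\<theta>}. eigenspace smul T \<mu>). E v = 0))"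

text \<open>The primitive idempotents of \<open>As\<close> are indexed by its eigenvalues, not by \<open>0, \<dots>, d\<close>: the sum
  does not depend on how the eigenvalues are ordered.\<close>

definition flat_part ::
  "('a::field \<Rightarrow> 'v::ab_group_add \<Rightarrow> 'v) \<Rightarrow> ('v \<Rightarrow> 'v) \<Rightarrow> ('v \<Rightarrow> 'v) \<Rightarrow> 'v \<Rightarrow> 'v" where
  "flat_part smul A As v =
     (\<Sum>\<theta>\<in>eigenvalues smul As.
        primitive_idempotent smul As \<theta> (A (primitive_idempotent smul As \<theta> v)))"

definition near_bipartite ::
  "('a::field \<Rightarrow> 'v::ab_group_add \<Rightarrow> 'v) \<Rightarrow> nat \<Rightarrow> ('v \<Rightarrow> 'v) \<Rightarrow> ('v \<Rightarrow> 'v) \<Rightarrow> bool" where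
  "near_bipartite smul d A As \<longleftrightarrow>
     leonard_pair smul d A As \<and> leonard_pair smul d (\<lambda>v. A v - flat_part smul A As v) As"

text \<open>The pair \<open>B, Bs\<close> is the bipartite contraction of the pair \<open>A, As\<close>.\<close>

definition is_bipartite_contraction ::
  "('a::field \<Rightarrow> 'v::ab_group_add \<Rightarrow> 'v) \<Rightarrow> nat \<Rightarrow> ('v \<Rightarrow> 'v) \<Rightarrow> ('v \<Rightarrow> 'v) \<Rightarrow> ('v \<Rightarrow> 'v) \<Rightarrow> ('v \<Rightarrow> 'v) \<Rightarrow> bool"
  where
  "is_bipartite_contraction smul d A As B Bs \<longleftrightarrow>
     near_bipartite smul d A As \<and> B = (\<lambda>v. A v - flat_part smul A As v) \<and> Bs = As"

end

theory Submission
  imports Defs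
begin

text \<open>The Leonard pair \<open>A, A\<^sup>*\<close> forces the diagonal entries of \<open>A\<^sup>*\<close> to be distinct, because the eigenspaces
  of an irreducible tridiagonal matrix are lines, and it forces \<open>x\<^sub>1\<close> and \<open>x\<^sub>2\<close> to be nonzero. So the
  flat part of \<open>A\<close> is its diagonal, \<open>A - F = B\<close>, and the question is when \<open>B, A\<^sup>*\<close> is a Leonard pair.
  The eigenvector of \<open>B\<close> for \<open>\<mu>\<close> is \<open>(\<mu>\<^sup>2 - x\<^sub>2, \<mu>, 1)\<close> with \<open>\<mu> \<in> {0, r, -r}\<close> and \<open>r\<^sup>2 = x\<^sub>1 + x\<^sub>2\<close>. If \<open>A\<^sup>*\<close> is
  irreducible tridiagonal in an ordering of these eigenvectors, then the one for \<open>\<mu> = 0\<close> is in the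
  middle. For the ordering \<open>r, 0, -r\<close> the two corner entries vanish exactly if
  \<open>x\<^sub>1 (\<theta>\<^sup>*\<^sub>0 - \<theta>\<^sup>*\<^sub>1) = x\<^sub>2 (\<theta>\<^sup>*\<^sub>1 - \<theta>\<^sup>*\<^sub>2)\<close>.\<close>

no_notation fps_nth (infixl "$" 75)

section \<open>Coordinates with respect to an ordered basis\<close>

lemma sum_atMost_2: "(\<Sum>i\<le>(2::nat). f i) = f 0 + f 1 + f 2"
  by (simp add: eval_nat_numeral)

context vector_space
begin

lemma ordered_basis_zero_coeff:
  assumes "ordered_basis scale d v" and "(\<Sum>i\<le>d. scale (c i) (v i)) = 0" and "k \<le> d"
  shows "c k = 0"
proof -
  have inj: "inj_on v {..d}" and ind: "independent (v ` {..d})"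
    using assms(1) by (auto simp: ordered_basis_def)
  \<comment> \<open>Independence speaks of coefficients indexed by vectors; \<open>inv_into\<close>
    moves the index from \<open>i\<close> to \<open>v i\<close>.\<close>
  have "(\<Sum>b\<in>v ` {..d}. scale (c (inv_into {..d} v b)) b) = 0"
    using assms(2) inj by (simp add: sum.reindex)
  then have "c (inv_into {..d} v (v k)) = 0"
    using assms(3) by (intro independentD[OF ind]) auto
  then show ?thesis
    using inj assms(3) by simp
qed

lemma ordered_basis_coeff_unique:
  assumes "ordered_basis scale d v"
    and "(\<Sum>i\<le>d. scale (c i) (v i)) = (\<Sum>i\<le>d. scale (c' i) (v i))" and "k \<le> d"
  shows "c k = c' k"
  using ordered_basis_zero_coeff[of d v "\<lambda>i. c i - c' i" k] assms
  by (simp add: scale_left_diff_distrib sum_subtractf)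

lemma ordered_basis_expansion:
  assumes "ordered_basis scale d v"
  shows "(\<Sum>i\<le>d. scale (representation (v ` {..d}) x (v i)) (v i)) = x"
proof -
  have "(\<Sum>b\<in>v ` {..d}. scale (representation (v ` {..d}) x b) b) = x"
    using assms by (intro sum_representation_eq) (auto simp: ordered_basis_def)
  then show ?thesis
    using assms by (simp add: ordered_basis_def sum.reindex)
qed

lemma ordered_basisI:
  assumes indep: "\<And>c k. (\<Sum>i\<le>d. scale (c i) (v i)) = 0 \<Longrightarrow> k \<le> d \<Longrightarrow> c k = 0"
    and spans: "\<And>x. \<exists>c. x = (\<Sum>i\<le>d. scale (c i) (v i))"
  shows "ordered_basis scale d v"
proof -
  have inj: "inj_on v {..d}"
  proof (rule inj_onI, rule ccontr)
    fix i j assume ij: "i \<in> {..d}" "j \<in> {..d}" "v i = v j" "i \<noteq> j"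
    \<comment> \<open>A repeated vector would give the nontrivial relation
      \<open>v i - v j = 0\<close>.\<close>
    let ?c = "\<lambda>k. if k = i then 1 else if k = j then - 1 else 0"
    have "(\<Sum>k\<le>d. scale (?c k) (v k)) = (\<Sum>k\<in>{i, j}. scale (?c k) (v k))"
      using ij by (intro sum.mono_neutral_right) auto
    also have "\<dots> = 0"
      using ij by simp
    finally show False
      using indep[of ?c i] ij by simp
  qed
  have "independent (v ` {..d})"
  proof (rule independent_if_scalars_zero)
    fix f x assume f: "(\<Sum>x\<in>v ` {..d}. scale (f x) x) = 0" and "x \<in> v ` {..d}"
    then obtain k where "k \<le> d" "x = v k" by auto
    then show "f x = 0"
      using f indep[of "\<lambda>i. f (v i)" k] inj by (simp add: sum.reindex)
  qed simp
  moreover have "x \<in> span (v ` {..d})" for x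
  proof -
    obtain c where "x = (\<Sum>i\<le>d. scale (c i) (v i))" using spans by blast
    also have "\<dots> \<in> span (v ` {..d})" by (intro span_sum span_scale span_base) simp
    finally show ?thesis .
  qed
  ultimately show ?thesis
    using inj by (auto simp: ordered_basis_def)
qed

section \<open>Matrices of an operator in an ordered basis\<close>

lemma matrix_wrt_expansion:
  assumes "ordered_basis scale d v"
  shows "T (v j) = (\<Sum>i\<le>d. scale (matrix_wrt scale d v T i j) (v i))"
  using ordered_basis_expansion[OF assms, of "T (v j)"] by (simp add: matrix_wrt_def)

lemma matrix_wrt_eqI:
  assumes "ordered_basis scale d v" and "T (v j) = (\<Sum>i\<le>d. scale (c i) (v i))" and "k \<le> d"
  shows "matrix_wrt scale d v T k j = c k"
  by (rule ordered_basis_coeff_unique[OF assms(1) _ assms(3)])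
    (simp add: assms(2) flip: matrix_wrt_expansion[OF assms(1)])

lemma ordered_basis_nonzero:
  assumes "ordered_basis scale d v" and "k \<le> d"
  shows "v k \<noteq> 0"
  using assms dependent_zero[of "v ` {..d}"] by (auto simp: ordered_basis_def)

lemma ordered_basis_not_parallel:
  assumes "ordered_basis scale d v" and "i \<le> d" "j \<le> d" "i \<noteq> j" and "scale a (v i) = scale b (v j)"
  shows "a = 0"
proof -
  let ?c = "\<lambda>k. if k = i then a else if k = j then - b else 0"
  have "(\<Sum>k\<le>d. scale (?c k) (v k)) = (\<Sum>k\<in>{i, j}. scale (?c k) (v k))"
    using assms by (intro sum.mono_neutral_right) auto
  also have "\<dots> = 0"
    using assms by simp
  finally show ?thesis
    using ordered_basis_zero_coeff[OF assms(1), of ?c i] assms(2) by simp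
qed

lemma diagonal_mat_eigenvector:
  assumes "ordered_basis scale d v" and "diagonal_mat d (matrix_wrt scale d v T)" and "j \<le> d"
  shows "T (v j) = scale (matrix_wrt scale d v T j j) (v j)"
proof -
  have "T (v j) = (\<Sum>i\<le>d. scale (matrix_wrt scale d v T i j) (v i))"
    by (rule matrix_wrt_expansion[OF assms(1)])
  also have "\<dots> = (\<Sum>i\<in>{j}. scale (matrix_wrt scale d v T i j) (v i))"
    using assms(2,3) by (intro sum.mono_neutral_right) (auto simp: diagonal_mat_def)
  finally show ?thesis by simp
qed

lemma diagonal_matI:
  assumes "ordered_basis scale d v" and "\<And>j. j \<le> d \<Longrightarrow> T (v j) = scale (\<mu> j) (v j)"
  shows "diagonal_mat d (matrix_wrt scale d v T)"
  unfolding diagonal_mat_def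
proof (intro allI impI)
  fix i j assume ij: "i \<le> d" "j \<le> d" "i \<noteq> j"
  have "(\<Sum>i\<le>d. scale (if i = j then \<mu> j else 0) (v i)) = (\<Sum>i\<in>{j}. scale (if i = j then \<mu> j else 0) (v i))"
    using ij by (intro sum.mono_neutral_right) auto
  then have "T (v j) = (\<Sum>i\<le>d. scale (if i = j then \<mu> j else 0) (v i))"
    using assms(2) ij by simp
  then show "matrix_wrt scale d v T i j = 0"
    using matrix_wrt_eqI[OF assms(1) _ ij(1), of T j "\<lambda>i. if i = j then \<mu> j else 0"] ij by simp
qed

text \<open>Row \<open>k\<close> of the eigenvalue equation expresses the coordinate \<open>k + 1\<close> of an eigenvector by its
  coordinates up to \<open>k\<close>.\<close>

lemma irreducible_tridiagonal_eigenvector_zero: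
  assumes basis: "ordered_basis scale d v" and lin: "Vector_Spaces.linear scale scale T"
    and irr: "irreducible_tridiagonal_mat d (matrix_wrt scale d v T)"
    and x: "x = (\<Sum>i\<le>d. scale (c i) (v i))" and eig: "T x = scale \<mu> x" and c0: "c 0 = 0"
  shows "x = 0"
proof -
  interpret T: Vector_Spaces.linear scale scale T by (fact lin)
  let ?M = "matrix_wrt scale d v T"
  have "T x = (\<Sum>j\<le>d. scale (c j) (T (v j)))"
    by (simp add: x T.sum T.scale)
  also have "\<dots> = (\<Sum>j\<le>d. scale (c j) (\<Sum>i\<le>d. scale (?M i j) (v i)))"
    by (simp flip: matrix_wrt_expansion[OF basis])
  also have "\<dots> = (\<Sum>j\<le>d. \<Sum>i\<le>d. scale (?M i j * c j) (v i))"
    by (simp add: scale_sum_right mult.commute)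
  also have "\<dots> = (\<Sum>i\<le>d. scale (\<Sum>j\<le>d. ?M i j * c j) (v i))"
    by (subst sum.swap) (simp add: scale_sum_left)
  finally have "(\<Sum>i\<le>d. scale (\<Sum>j\<le>d. ?M i j * c j) (v i)) = (\<Sum>i\<le>d. scale (\<mu> * c i) (v i))"
    using eig x by (simp add: scale_sum_right)
  then have row: "(\<Sum>j\<le>d. ?M i j * c j) = \<mu> * c i" if "i \<le> d" for i
    by (rule ordered_basis_coeff_unique[OF basis _ that])
  have "c k = 0" if "k \<le> d" for k
    using that
  proof (induction k rule: less_induct)
    case (less k)
    show ?case
    proof (cases k)
      case 0
      then show ?thesis using c0 by simp
    next
      case (Suc m)
      \<comment> \<open>In row \<open>m\<close>, the columns before \<open>k\<close> drop out by
        induction and those after \<open>k\<close> by tridiagonality. Only the nonzero superdiagonal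
        entry \<open>?M m k\<close> is left.\<close>
      have "(\<Sum>j\<le>d. ?M m j * c j) = (\<Sum>j\<in>{k}. ?M m j * c j)"
      proof (rule sum.mono_neutral_right)
        show "\<forall>j\<in>{..d} - {k}. ?M m j * c j = 0"
        proof
          fix j assume "j \<in> {..d} - {k}"
          then consider "j < k" "j \<le> d" | "j > Suc m" "j \<le> d"
            using Suc by force
          then show "?M m j * c j = 0"
          proof cases
            case 1
            then show ?thesis using less.IH by simp
          next
            case 2
            then have "m \<le> d" "\<not> (m = j \<or> m = Suc j \<or> j = Suc m)" by auto
            then have "?M m j = 0"
              using irr 2 unfolding irreducible_tridiagonal_mat_def tridiagonal_mat_def by blast
            then show ?thesis by simp
          qed
        qed
      qed (use less in auto)
      then have "?M m k * c k = \<mu> * c m"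
        using row[of m] less.prems Suc by simp
      also have "c m = 0"
        using less Suc by simp
      finally show ?thesis
        using irr less.prems Suc by (simp add: irreducible_tridiagonal_mat_def)
    qed
  qed
  then show ?thesis by (simp add: x)
qed

text \<open>A combination of \<open>x\<close> and \<open>y\<close> in which coordinate 0 cancels is
  again in the eigenspace, hence zero by the preceding lemma. The weights are the coordinates 0
  themselves; if both vanish, then already \<open>x = 0\<close>.\<close>

lemma leonard_pair_eigenvectors_parallel:
  assumes "leonard_pair scale d A T" and "T x = scale \<mu> x" "T y = scale \<mu> y"
  shows "\<exists>a b. (a \<noteq> 0 \<or> b \<noteq> 0) \<and> scale a x = scale b y"
proof -
  obtain v where v: "ordered_basis scale d v" "irreducible_tridiagonal_mat d (matrix_wrt scale d v T)"
    and lin: "Vector_Spaces.linear scale scale T"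
    using assms(1) by (auto simp: leonard_pair_def)
  interpret T: Vector_Spaces.linear scale scale T by (fact lin)
  define c where "c z i = representation (v ` {..d}) z (v i)" for z i
  have c: "z = (\<Sum>i\<le>d. scale (c z i) (v i))" for z
    using ordered_basis_expansion[OF v(1)] by (simp add: c_def)
  show ?thesis
  proof (cases "c x 0 = 0 \<and> c y 0 = 0")
    case True
    then have "x = 0"
      using irreducible_tridiagonal_eigenvector_zero[OF v(1) lin v(2) c[of x] assms(2)] by simp
    then show ?thesis by (intro exI[of _ 1] exI[of _ 0]) simp
  next
    case False
    let ?z = "scale (c y 0) x - scale (c x 0) y"
    have "(\<Sum>i\<le>d. scale (c y 0 * c x i - c x 0 * c y i) (v i)) =
        scale (c y 0) (\<Sum>i\<le>d. scale (c x i) (v i)) - scale (c x 0) (\<Sum>i\<le>d. scale (c y i) (v i))"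
      by (simp add: scale_left_diff_distrib scale_sum_right sum_subtractf)
    then have "?z = (\<Sum>i\<le>d. scale (c y 0 * c x i - c x 0 * c y i) (v i))"
      by (simp flip: c)
    moreover have "T ?z = scale \<mu> ?z"
      by (simp add: T.diff T.scale assms scale_right_diff_distrib mult.commute)
    ultimately have "?z = 0"
      by (rule irreducible_tridiagonal_eigenvector_zero[OF v(1) lin v(2)]) simp
    then show ?thesis
      using False by (intro exI[of _ "c y 0"] exI[of _ "c x 0"]) auto
  qed
qed

text \<open>The absence of \<open>v 2\<close> from \<open>T (v 0)\<close> and of \<open>v 0\<close>
  from \<open>T (v 2)\<close> is the vanishing of the two corners. The \<open>b\<close> are the
  subdiagonal entries and the \<open>c\<close> the superdiagonal ones.\<close>

lemma irreducible_tridiagonal_mat_2I: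
  assumes "ordered_basis scale 2 v"
    and "T (v 0) = scale a\<^sub>0 (v 0) + scale b\<^sub>0 (v 1)"
    and "T (v 1) = scale c\<^sub>1 (v 0) + scale a\<^sub>1 (v 1) + scale b\<^sub>1 (v 2)"
    and "T (v 2) = scale c\<^sub>2 (v 1) + scale a\<^sub>2 (v 2)"
    and "b\<^sub>0 \<noteq> 0" "c\<^sub>1 \<noteq> 0" "b\<^sub>1 \<noteq> 0" "c\<^sub>2 \<noteq> 0"
  shows "irreducible_tridiagonal_mat 2 (matrix_wrt scale 2 v T)"
proof -
  note entry = matrix_wrt_eqI[OF assms(1), of T]
  have 0: "matrix_wrt scale 2 v T k 0 = (\<lambda>i. if i = 0 then a\<^sub>0 else if i = 1 then b\<^sub>0 else 0) k"
    if "k \<le> 2" for k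
    using that assms(2) by (intro entry) (simp_all add: sum_atMost_2)
  have 1: "matrix_wrt scale 2 v T k 1 = (\<lambda>i. if i = 0 then c\<^sub>1 else if i = 1 then a\<^sub>1 else b\<^sub>1) k"
    if "k \<le> 2" for k
    using that assms(3) by (intro entry) (simp_all add: sum_atMost_2)
  have 2: "matrix_wrt scale 2 v T k 2 = (\<lambda>i. if i = 0 then 0 else if i = 1 then c\<^sub>2 else a\<^sub>2) k"
    if "k \<le> 2" for k
    using that assms(4) by (intro entry) (simp_all add: sum_atMost_2)
  have le_2: "i \<le> 2 \<longleftrightarrow> i = 0 \<or> i = 1 \<or> i = 2" and less_2: "i < 2 \<longleftrightarrow> i = 0 \<or> i = 1" for i :: nat
    by auto
  show ?thesis
    using 0[of 0] 0[of 1] 0[of 2] 1[of 0] 1[of 1] 1[of 2] 2[of 0] 2[of 1] 2[of 2] assms(5-8)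
    unfolding irreducible_tridiagonal_mat_def tridiagonal_mat_def le_2 less_2
    by (auto simp: numeral_2_eq_2)
qed

end

section \<open>Diagonal operators\<close>

definition diag_op :: "('n \<Rightarrow> 'a::field) \<Rightarrow> 'a ^ 'n \<Rightarrow> 'a ^ 'n" where
  "diag_op t x = (\<chi> i. t i * x $ i)"

lemma diag_op_nth [simp]: "diag_op t x $ i = t i * x $ i"
  by (simp add: diag_op_def)

lemma linear_diag_op: "Vector_Spaces.linear (*s) (*s) (diag_op t)"
  by unfold_locales (simp_all add: vec_eq_iff algebra_simps)

lemma diag_op_axis: "diag_op t (axis i c) = t i *s axis i c"
  by (simp add: vec_eq_iff axis_def)

text \<open>Equal diagonal entries would put two unit vectors into one eigenspace, where any two
  vectors are parallel.\<close>

lemma leonard_pair_diag_op_inj: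
  fixes t :: "'n::finite \<Rightarrow> 'a::field"
  assumes "leonard_pair (*s) d A (diag_op t)"
  shows "inj t"
proof (rule injI, rule ccontr)
  fix p q assume "t p = t q" "p \<noteq> q"
  then have "diag_op t (axis q 1) = t p *s axis q 1"
    by (simp add: diag_op_axis)
  then obtain a b where ab: "a \<noteq> 0 \<or> b \<noteq> 0" "a *s axis p 1 = b *s axis q (1 :: 'a)"
    using vec.leonard_pair_eigenvectors_parallel[OF assms diag_op_axis] by blast
  have "(a *s axis p 1) $ k = (b *s axis q (1 :: 'a)) $ k" for k
    using ab(2) by (rule arg_cong)
  from this[of p] this[of q] show False
    using ab(1) \<open>p \<noteq> q\<close> by (simp add: axis_def)
qed

section \<open>Eigenspaces, primitive idempotents and flat part for a diagonal operator\<close>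

lemma eigenspace_diag_op:
  assumes "inj t"
  shows "eigenspace (*s) (diag_op t) (t i) = {x. \<forall>k. k \<noteq> i \<longrightarrow> x $ k = 0}"
  using assms by (auto simp: eigenspace_def vec_eq_iff inj_eq)

lemma eigenvalues_diag_op:
  fixes t :: "'n::finite \<Rightarrow> 'a::field"
  shows "eigenvalues (*s) (diag_op t) = range t"
proof -
  have "\<theta> \<in> range t" if x: "diag_op t x = \<theta> *s x" "x \<noteq> 0" for \<theta> x
  proof -
    obtain i where "x $ i \<noteq> 0"
      using x(2) by (auto simp: vec_eq_iff)
    moreover have "t i * x $ i = \<theta> * x $ i"
      using x(1) by (metis diag_op_nth vector_smult_component)
    ultimately show ?thesis by auto
  qed
  moreover have "t i \<in> eigenvalues (*s) (diag_op t)" for i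
    unfolding eigenvalues_def eigenspace_def
    using diag_op_axis[of t i 1] by (auto intro!: bexI[of _ "axis i 1"] simp: axis_eq_0_iff)
  ultimately show ?thesis
    by (auto simp: eigenvalues_def eigenspace_def)
qed

text \<open>For injective \<open>t\<close> the eigenspaces are the coordinate axes, so the two
  requirements on the projection fix its value at every unit vector. This is the uniqueness that
  \<open>THE\<close> asks for.\<close>

lemma primitive_idempotent_diag_op:
  fixes t :: "'n::finite \<Rightarrow> 'a::field"
  assumes "inj t"
  shows "primitive_idempotent (*s) (diag_op t) (t i) = (\<lambda>x. axis i (x $ i))"
proof -
  let ?S = "vec.span (\<Union>\<mu>\<in>range t - {t i}. eigenspace (*s) (diag_op t) \<mu>)"
  have S: "x $ i = 0" if "x \<in> ?S" for x
    using that
  proof (induction rule: vec.span_induct_alt)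
    case (step c x y)
    then obtain j where "t j \<noteq> t i" "x \<in> eigenspace (*s) (diag_op t) (t j)" by auto
    with step show ?case by (auto simp: eigenspace_diag_op[OF assms])
  qed simp
  show ?thesis
    unfolding primitive_idempotent_def eigenvalues_diag_op
  proof (rule the_equality, intro conjI ballI)
    show "Vector_Spaces.linear (*s) (*s) (\<lambda>x. axis i (x $ i))"
      by unfold_locales (auto simp: vec_eq_iff axis_def)
    show "axis i (x $ i) = x" if "x \<in> eigenspace (*s) (diag_op t) (t i)" for x
      using that by (auto simp: eigenspace_diag_op[OF assms] vec_eq_iff axis_def)
    show "axis i (x $ i) = 0" if "x \<in> ?S" for x
      using S[OF that] by (simp add: axis_eq_0_iff)
  next
    fix E assume E: "Vector_Spaces.linear (*s) (*s) E \<and>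
        (\<forall>x\<in>eigenspace (*s) (diag_op t) (t i). E x = x) \<and> (\<forall>x\<in>?S. E x = 0)"
    then interpret E: Vector_Spaces.linear "(*s)" "(*s)" E by blast
    have ax: "axis j c \<in> eigenspace (*s) (diag_op t) (t j)" for j c
      by (simp add: eigenspace_def diag_op_axis)
    have "E (axis j c) = (if j = i then axis j c else 0)" for j c
    proof (cases "j = i")
      case False
      then have "axis j c \<in> ?S"
        using ax[of j c] assms by (intro vec.span_base) (auto simp: inj_eq)
      then show ?thesis using E False by simp
    qed (use E ax in auto)
    then have "E (\<Sum>j\<in>UNIV. axis j (x $ j)) = axis i (x $ i)" for x
      by (simp add: E.sum)
    moreover have "(\<Sum>j\<in>UNIV. axis j (x $ j)) = x" for x :: "'a ^ 'n"
      by (simp add: vec_eq_iff axis_def)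
    ultimately show "E = (\<lambda>x. axis i (x $ i))" by auto
  qed
qed

text \<open>Injectivity of \<open>t\<close> turns the sum over eigenvalues into a sum over
  coordinates, and cutting \<open>A\<close> down to one axis on both sides leaves its diagonal
  entry.\<close>

lemma flat_part_diag_op:
  fixes t :: "'n::finite \<Rightarrow> 'a::field"
  assumes "inj t"
  shows "flat_part (*s) ((*v) A) (diag_op t) = diag_op (\<lambda>i. A $ i $ i)"
proof
  fix x :: "'a ^ 'n"
  have mult: "(A *v axis i c) $ i = A $ i $ i * c" for i c
    by (simp add: matrix_vector_mult_def axis_def if_distrib cong: if_cong)
  have "flat_part (*s) ((*v) A) (diag_op t) x = (\<Sum>i\<in>UNIV. axis i (A $ i $ i * x $ i))"
    by (simp add: flat_part_def eigenvalues_diag_op sum.reindex[OF assms]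
        primitive_idempotent_diag_op[OF assms] mult)
  then show "flat_part (*s) ((*v) A) (diag_op t) x = diag_op (\<lambda>i. A $ i $ i) x"
    by (simp add: vec_eq_iff axis_def)
qed

text \<open>A basis diagonalizing \<open>diag_op t\<close> consists of multiples of the unit vectors, so up to order and
  scaling \<open>A\<close> itself is irreducible tridiagonal.\<close>

lemma leonard_pair_diag_op_zero_pattern:
  fixes t :: "'n::finite \<Rightarrow> 'a::field"
  assumes leonard: "leonard_pair (*s) d ((*v) A) (diag_op t)" and zero: "A $ p $ q = 0"
  shows "A $ q $ p = 0"
proof (cases "p = q")
  case False
  have t: "inj t" by (rule leonard_pair_diag_op_inj[OF leonard])
  obtain v where v: "ordered_basis (*s) d v"
    "irreducible_tridiagonal_mat d (matrix_wrt (*s) d v ((*v) A))"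
    "diagonal_mat d (matrix_wrt (*s) d v (diag_op t))"
    using leonard by (auto simp: leonard_pair_def)
  let ?M = "matrix_wrt (*s) d v ((*v) A)"
  \<comment> \<open>As \<open>t\<close> is injective, an eigenvector of \<open>diag_op t\<close>
    lies on a single axis.\<close>
  have supp: "v i $ l = 0" if "i \<le> d" "v i $ k \<noteq> 0" "l \<noteq> k" for i k l
  proof -
    have "diag_op t (v i) = matrix_wrt (*s) d v (diag_op t) i i *s v i"
      by (rule vec.diagonal_mat_eigenvector[OF v(1,3) that(1)])
    then have "t m * v i $ m = matrix_wrt (*s) d v (diag_op t) i i * v i $ m" for m
      by (metis diag_op_nth vector_smult_component)
    from this[of k] this[of l] show ?thesis
      using that(2,3) injD[OF t] by (metis mult_right_cancel)
  qed
  \<comment> \<open>Otherwise coordinate \<open>k\<close> would vanish on the whole span, which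
    contains \<open>axis k 1\<close>.\<close>
  have ex: "\<exists>i\<le>d. v i $ k \<noteq> 0" for k
  proof (rule ccontr)
    assume "\<not> ?thesis"
    then have "(\<Sum>i\<le>d. vec.representation (v ` {..d}) (axis k 1) (v i) *s v i) $ k = 0"
      by simp
    then show False
      by (simp add: vec.ordered_basis_expansion[OF v(1)])
  qed
  \<comment> \<open>Two basis vectors on the same axis would be parallel.\<close>
  have unique: "v l $ k = 0" if "i \<le> d" "v i $ k \<noteq> 0" "l \<le> d" "l \<noteq> i" for i k l
  proof (rule ccontr)
    assume "v l $ k \<noteq> 0"
    then have "v l $ k *s v i = v i $ k *s v l"
      using supp that by (auto simp: vec_eq_iff) (metis mult.commute mult_zero_right)
    then show False
      using vec.ordered_basis_not_parallel[OF v(1) that(1,3)] that(4) \<open>v l $ k \<noteq> 0\<close> by metis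
  qed
  \<comment> \<open>Hence \<open>A\<close> and \<open>?M\<close> agree up to a permutation of the
    axes and nonzero factors.\<close>
  have entry: "A $ k $ l * v j $ l = ?M i j * v i $ k"
    if "i \<le> d" "v i $ k \<noteq> 0" "j \<le> d" "v j $ l \<noteq> 0" for i j k l
  proof -
    have "(\<Sum>m\<in>UNIV. A $ k $ m * v j $ m) = (\<Sum>m\<in>{l}. A $ k $ m * v j $ m)"
      using supp[OF that(3,4)] by (intro sum.mono_neutral_right) auto
    then have "(A *v v j) $ k = A $ k $ l * v j $ l"
      by (simp add: matrix_vector_mult_def)
    moreover have "(A *v v j) $ k = (\<Sum>m\<le>d. ?M m j * v m $ k)"
      by (subst vec.matrix_wrt_expansion[OF v(1), of "(*v) A" j]) simp
    moreover have "(\<Sum>m\<le>d. ?M m j * v m $ k) = (\<Sum>m\<in>{i}. ?M m j * v m $ k)"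
      using unique[OF that(1,2)] that(1) by (intro sum.mono_neutral_right) auto
    ultimately show ?thesis by simp
  qed
  obtain i j where i: "i \<le> d" "v i $ p \<noteq> 0" and j: "j \<le> d" "v j $ q \<noteq> 0"
    using ex by meson
  have "i \<noteq> j"
    using supp i j False by blast
  \<comment> \<open>Off the diagonal, an irreducible tridiagonal matrix vanishes exactly where the
    indices are not adjacent, a condition symmetric in \<open>i\<close> and
    \<open>j\<close>.\<close>
  have "?M i j = 0"
    using entry[OF i j] zero i by simp
  then have "\<not> (i = Suc j \<or> j = Suc i)"
    using v(2) i j by (auto simp: irreducible_tridiagonal_mat_def)
  then have "?M j i = 0"
    using v(2) i j \<open>i \<noteq> j\<close> unfolding irreducible_tridiagonal_mat_def tridiagonal_mat_def by blast
  then show ?thesis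
    using entry[OF j i] i by simp
qed (use zero in simp)

section \<open>Tridiagonal matrices of size three with zero diagonal\<close>

lemma matrix_vector_mult_3:
  fixes M :: "'a::semiring_1 ^ 3 ^ 3"
  shows "M *v x = y \<longleftrightarrow>
    y $ 1 = M $ 1 $ 1 * x $ 1 + M $ 1 $ 2 * x $ 2 + M $ 1 $ 3 * x $ 3 \<and>
    y $ 2 = M $ 2 $ 1 * x $ 1 + M $ 2 $ 2 * x $ 2 + M $ 2 $ 3 * x $ 3 \<and>
    y $ 3 = M $ 3 $ 1 * x $ 1 + M $ 3 $ 2 * x $ 2 + M $ 3 $ 3 * x $ 3"
  by (auto simp: vec_eq_iff forall_3 matrix_vector_mult_def sum_3)

definition bip :: "'a::field \<Rightarrow> 'a \<Rightarrow> 'a ^ 3 ^ 3" where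
  "bip x1 x2 = vector [vector [0, x1, 0], vector [1, 0, x2], vector [0, 1, 0]]"

text \<open>The solution of the last two rows of the eigenvalue equation for
  \<open>bip x1 x2\<close>, with last coordinate 1.\<close>

definition bip_eigenvector :: "'a::field \<Rightarrow> 'a \<Rightarrow> 'a ^ 3" where
  "bip_eigenvector x2 \<mu> = vector [\<mu>\<^sup>2 - x2, \<mu>, 1]"

text \<open>Rows two and three express \<open>u\<close> by \<open>u $ 3\<close>; row one then
  becomes the characteristic equation of \<open>bip x1 x2\<close>.\<close>

lemma bip_eigenvector_unique:
  assumes "bip x1 x2 *v u = \<mu> *s u"
  shows "u = u $ 3 *s bip_eigenvector x2 \<mu>"
    and "u \<noteq> 0 \<Longrightarrow> \<mu> ^ 3 = (x1 + x2) * \<mu>" and "u \<noteq> 0 \<Longrightarrow> u $ 3 \<noteq> 0"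
proof -
  have eqs: "\<mu> * u $ 1 = x1 * u $ 2" "\<mu> * u $ 2 = u $ 1 + x2 * u $ 3" "\<mu> * u $ 3 = u $ 2"
    using assms by (simp_all add: matrix_vector_mult_3 bip_def)
  then have u: "u $ 2 = \<mu> * u $ 3" "u $ 1 = (\<mu>\<^sup>2 - x2) * u $ 3"
    by (simp_all add: algebra_simps power2_eq_square)
  show "u = u $ 3 *s bip_eigenvector x2 \<mu>"
    by (simp add: vec_eq_iff forall_3 bip_eigenvector_def u mult.commute)
  show u3: "u $ 3 \<noteq> 0" if "u \<noteq> 0"
    using that by (auto simp: vec_eq_iff forall_3 u)
  have "u $ 3 * \<mu> ^ 3 = u $ 3 * ((x1 + x2) * \<mu>)" if "u \<noteq> 0"
    using eqs(1) unfolding u by (simp add: algebra_simps power2_eq_square power3_eq_cube)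
  then show "\<mu> ^ 3 = (x1 + x2) * \<mu>" if "u \<noteq> 0"
    using that u3 by simp
qed

lemma bip_eigenvector_eigen:
  assumes "\<mu> ^ 3 = (x1 + x2) * \<mu>"
  shows "bip x1 x2 *v bip_eigenvector x2 \<mu> = \<mu> *s bip_eigenvector x2 \<mu>"
  using assms
  by (simp add: matrix_vector_mult_3 bip_def bip_eigenvector_def algebra_simps power2_eq_square
      power3_eq_cube)

text \<open>Meant for \<mu> at an end of the ordering and \<nu> in the middle. If \<mu> were 0, the
  second coordinate would give \<open>b = 0\<close>, and the other two \<open>t 1 = a = t 3\<close>.
  If \<nu> is 0, the last two coordinates give \<open>a = t 2\<close> and
  \<open>b = t 3 - t 2\<close>, and the first becomes the claim.\<close>

lemma diag_op_bip_eigenvector_middle: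
  fixes t :: "3 \<Rightarrow> 'a::field"
  assumes "diag_op t (bip_eigenvector x2 \<mu>) = a *s bip_eigenvector x2 \<mu> + b *s bip_eigenvector x2 \<nu>"
    and "inj t" "x2 \<noteq> 0" "\<mu> \<noteq> \<nu>"
  shows "\<mu> \<noteq> 0" and "\<nu> = 0 \<Longrightarrow> (\<mu>\<^sup>2 - x2) * (t 1 - t 2) = x2 * (t 2 - t 3)"
proof -
  have eqs: "t 1 * (\<mu>\<^sup>2 - x2) = a * (\<mu>\<^sup>2 - x2) + b * (\<nu>\<^sup>2 - x2)" "t 2 * \<mu> = a * \<mu> + b * \<nu>" "t 3 = a + b"
    using assms(1) by (simp_all add: vec_eq_iff forall_3 bip_eigenvector_def)
  have "t 1 \<noteq> t 3"
    using injD[OF assms(2), of 1 3] by auto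
  then show \<mu>: "\<mu> \<noteq> 0"
    using eqs assms(3,4) by auto
  show "(\<mu>\<^sup>2 - x2) * (t 1 - t 2) = x2 * (t 2 - t 3)" if "\<nu> = 0"
    using eqs \<mu> that by (simp add: algebra_simps)
qed

lemma leonard_pair_bip_imp:
  fixes t :: "3 \<Rightarrow> 'a::field"
  assumes leonard: "leonard_pair (*s) 2 ((*v) (bip x1 x2)) (diag_op t)" and "x2 \<noteq> 0"
  shows "x1 * (t 1 - t 2) = x2 * (t 2 - t 3)"
proof -
  have t: "inj t" by (rule leonard_pair_diag_op_inj[OF leonard])
  obtain v where v: "ordered_basis (*s) 2 v"
    "irreducible_tridiagonal_mat 2 (matrix_wrt (*s) 2 v (diag_op t))"
    "diagonal_mat 2 (matrix_wrt (*s) 2 v ((*v) (bip x1 x2)))"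
    using leonard by (auto simp: leonard_pair_def)
  define \<mu> where "\<mu> i = matrix_wrt (*s) 2 v ((*v) (bip x1 x2)) i i" for i
  let ?w = "\<lambda>i. bip_eigenvector x2 (\<mu> i)" and ?M = "matrix_wrt (*s) 2 v (diag_op t)"
  have eig: "bip x1 x2 *v v i = \<mu> i *s v i" if "i \<le> 2" for i
    unfolding \<mu>_def by (rule vec.diagonal_mat_eigenvector[OF v(1,3) that])
  note nz = vec.ordered_basis_nonzero[OF v(1)]
  have vw: "v i = v i $ 3 *s ?w i" and cubic: "\<mu> i ^ 3 = (x1 + x2) * \<mu> i" and v3: "v i $ 3 \<noteq> 0"
    if "i \<le> 2" for i
    by (rule bip_eigenvector_unique[OF eig[OF that]] nz[OF that])+
  have distinct: "\<mu> i \<noteq> \<mu> j" if "i \<le> 2" "j \<le> 2" "i \<noteq> j" for i j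
  proof
    assume eq: "\<mu> i = \<mu> j"
    have "v j $ 3 *s (v i $ 3 *s ?w i) = v i $ 3 *s (v j $ 3 *s ?w j)"
      by (simp add: eq mult.commute)
    then have "v j $ 3 *s v i = v i $ 3 *s v j"
      by (simp flip: vw[OF that(1)] vw[OF that(2)])
    then show False
      using vec.ordered_basis_not_parallel[OF v(1) that] v3[OF that(2)] by blast
  qed
  \<comment> \<open>With both corners zero, an end vector is sent to a combination of itself and the
    middle vector. The quotient comes from rescaling each \<open>v i\<close> to
    \<open>?w i\<close>.\<close>
  have neighbour: "diag_op t (?w i) = ?M i i *s ?w i + (?M 1 i * v 1 $ 3 / v i $ 3) *s ?w 1"
    if "i = 0 \<or> i = 2" for i
  proof -
    have i: "i \<le> 2" using that by auto
    have "?M a b = 0" if "a \<le> 2" "b \<le> 2" "\<not> (a = b \<or> a = Suc b \<or> b = Suc a)" for a b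
      using v(2) that unfolding irreducible_tridiagonal_mat_def tridiagonal_mat_def by blast
    from this[of 2 0] this[of 0 2] have "?M 2 0 = 0" "?M 0 2 = 0"
      by simp_all
    then have "diag_op t (v i) = ?M i i *s v i + ?M 1 i *s v 1"
      using vec.matrix_wrt_expansion[OF v(1), of "diag_op t" i] that by (auto simp: sum_atMost_2)
    then have "diag_op t (v i $ 3 *s ?w i) = ?M i i *s (v i $ 3 *s ?w i) + ?M 1 i *s (v 1 $ 3 *s ?w 1)"
      by (simp del: One_nat_def flip: vw[OF i] vw[of 1])
    then show ?thesis
      using v3[OF i] by (simp add: vec_eq_iff field_simps)
  qed
  note ends = diag_op_bip_eigenvector_middle[OF neighbour t \<open>x2 \<noteq> 0\<close> distinct]
  \<comment> \<open>So the ends are opposite square roots of \<open>x1 + x2\<close>, and a nonzero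
    middle eigenvalue would coincide with one of them.\<close>
  have "\<mu> 0 \<noteq> 0" "\<mu> 2 \<noteq> 0"
    using ends(1)[of 0] ends(1)[of 2] by simp_all
  then have sq: "(\<mu> 0)\<^sup>2 = x1 + x2" "(\<mu> 2)\<^sup>2 = x1 + x2"
    using cubic[of 0] cubic[of 2] by (simp_all add: power2_eq_square power3_eq_cube)
  have "\<mu> 2 = - \<mu> 0"
    using sq distinct[of 0 2] by (metis le0 order_refl power2_eq_iff zero_neq_numeral)
  moreover have "(\<mu> 1)\<^sup>2 = (\<mu> 0)\<^sup>2" if "\<mu> 1 \<noteq> 0"
    using that cubic[of 1] sq by (simp add: power2_eq_square power3_eq_cube)
  ultimately have "\<mu> 1 = 0"
    using distinct[of 1 0] distinct[of 1 2] by (auto simp: power2_eq_iff)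
  then show ?thesis
    using ends(2)[of 0] sq by simp
qed

section \<open>The unit basis and the eigenbasis of the bipartite matrix\<close>

lemma axis_ordered_basis_3:
  "ordered_basis (*s) 2 (\<lambda>i. axis (of_nat (Suc i)) 1 :: 'a::field ^ 3)"
proof (rule vec.ordered_basisI)
  fix c :: "nat \<Rightarrow> 'a" and k :: nat
  assume "(\<Sum>i\<le>2. c i *s axis (of_nat (Suc i)) 1 :: 'a ^ 3) = 0" "k \<le> 2"
  moreover from this(2) have "k = 0 \<or> k = 1 \<or> k = 2" by auto
  ultimately show "c k = 0"
    by (auto simp: sum_atMost_2 vec_eq_iff forall_3 axis_def)
next
  fix x :: "'a ^ 3"
  \<comment> \<open>The shift by \<open>Suc\<close> matches the indices 0, 1, 2 with the coordinates
    1, 2, 3.\<close>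
  have "x = (\<Sum>i\<le>2. x $ of_nat (Suc i) *s axis (of_nat (Suc i)) 1)"
    by (simp add: sum_atMost_2 vec_eq_iff forall_3 axis_def)
  then show "\<exists>c. x = (\<Sum>i\<le>2. c i *s axis (of_nat (Suc i)) 1)"
    by (intro exI[of _ "\<lambda>i. x $ of_nat (Suc i)"])
qed

text \<open>The scalars \<open>r * (1 - of_nat i)\<close> are the eigenvalues \<open>r, 0, -r\<close>.\<close>

lemma bip_eigenvector_ordered_basis:
  fixes r :: "'a::field"
  assumes two: "(2 :: 'a) \<noteq> 0" and r: "r \<noteq> 0"
  shows "ordered_basis (*s) 2 (\<lambda>i. bip_eigenvector x2 (r * (1 - of_nat i)))"
proof (rule vec.ordered_basisI)
  fix c :: "nat \<Rightarrow> 'a" and k :: nat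
  assume "(\<Sum>i\<le>2. c i *s bip_eigenvector x2 (r * (1 - of_nat i))) = 0" and k: "k \<le> 2"
  then have eqs: "c 0 * (r\<^sup>2 - x2) - c 1 * x2 + c 2 * (r\<^sup>2 - x2) = 0" "r * (c 0 - c 2) = 0"
    "c 0 + c 1 + c 2 = 0"
    by (simp_all add: sum_atMost_2 vec_eq_iff forall_3 bip_eigenvector_def algebra_simps)
  then have c2: "c 2 = c 0" using r by simp
  with eqs(3) have c1: "c 1 = - 2 * c 0" by (simp add: algebra_simps eq_neg_iff_add_eq_0)
  \<comment> \<open>After the substitution, the terms with \<open>x2\<close> cancel in the first
    coordinate.\<close>
  have "2 * r\<^sup>2 * c 0 = 0"
    using eqs(1) by (simp add: c1 c2 algebra_simps del: One_nat_def)
  then have "c 0 = 0" using two r by simp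
  moreover have "k = 0 \<or> k = 1 \<or> k = 2" using k by auto
  ultimately show "c k = 0" using c1 c2 by auto
next
  fix x :: "'a ^ 3"
  \<comment> \<open>Half the sum and half the difference of the outer coefficients: the first
    coordinate plus \<open>x2\<close> times the third determines \<open>c 0 + c 2\<close>, and the
    second determines \<open>c 0 - c 2\<close>.\<close>
  let ?a = "(x $ 1 + x2 * x $ 3) / (2 * r\<^sup>2)" and ?b = "x $ 2 / (2 * r)"
  have "z / (2 * w) + z / (2 * w) = z / w" for z w :: 'a
    using two by (metis add_divide_distrib mult_2 mult_divide_mult_cancel_left)
  then have half: "?a + ?a = (x $ 1 + x2 * x $ 3) / r\<^sup>2" "?b + ?b = x $ 2 / r"
    by blast+
  define c where "c = (\<lambda>i :: nat. if i = 0 then ?a + ?b else if i = 1 then x $ 3 - (?a + ?a) else ?a - ?b)"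
  have "r * (c 0 - c 2) = x $ 2"
    using r half(2) by (simp add: c_def field_simps)
  moreover have c02: "(c 0 + c 2) * r\<^sup>2 = x $ 1 + x2 * x $ 3" and c1: "c 1 = x $ 3 - (c 0 + c 2)"
    using r half(1) by (simp_all add: c_def)
  moreover have "(c 0 + c 2) * (r\<^sup>2 - x2) - c 1 * x2 = x $ 1"
    using c02 unfolding c1 by (simp add: algebra_simps)
  ultimately have "x = (\<Sum>i\<le>2. c i *s bip_eigenvector x2 (r * (1 - of_nat i)))"
    by (simp add: sum_atMost_2 vec_eq_iff forall_3 bip_eigenvector_def algebra_simps)
  then show "\<exists>c. x = (\<Sum>i\<le>2. c i *s bip_eigenvector x2 (r * (1 - of_nat i)))" by blast
qed

lemma leonard_pair_bipI:
  fixes t :: "3 \<Rightarrow> 'a::alg_closed_field"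
  assumes two: "(2 :: 'a) \<noteq> 0" and t: "inj t" and x: "x1 \<noteq> 0" "x2 \<noteq> 0"
    and eq: "x1 * (t 1 - t 2) = x2 * (t 2 - t 3)"
  shows "leonard_pair (*s) 2 ((*v) (bip x1 x2)) (diag_op t)"
proof -
  have ne: "t 1 \<noteq> t 2" "t 2 \<noteq> t 3" "t 1 \<noteq> t 3"
    using injD[OF t, of 1 2] injD[OF t, of 2 3] injD[OF t, of 1 3] by auto
  \<comment> \<open>This isolates \<open>x1 + x2\<close>, which must be nonzero for its square root
    \<open>r\<close> to give three distinct eigenvalues.\<close>
  have "(x1 + x2) * (t 1 - t 2) = x2 * (t 1 - t 3)"
    using eq by (simp add: algebra_simps)
  then have "x1 + x2 \<noteq> 0" using ne x by auto
  obtain r where r: "r\<^sup>2 = x1 + x2"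
    using nth_root_exists[of 2 "x1 + x2"] by auto
  have r0: "r \<noteq> 0" using r \<open>x1 + x2 \<noteq> 0\<close> by auto
  let ?e = "\<lambda>i. axis (of_nat (Suc i)) 1 :: 'a ^ 3"
  let ?v = "\<lambda>i. bip_eigenvector x2 (r * (1 - of_nat i))"
  \<comment> \<open>The coefficient of both outer vectors in \<open>diag_op t (?v 1)\<close>:
    coordinate 2 makes the two equal, and coordinates 1 and 3 determine their value.\<close>
  define b where "b = x2 * (t 3 - t 1) / (2 * r\<^sup>2)"
  have b: "2 * r\<^sup>2 * b = x2 * (t 3 - t 1)"
    using two r0 by (simp add: b_def)
  have "b \<noteq> 0" using b x ne by auto
  have x1: "x1 = r\<^sup>2 - x2" using r by simp
  note v = bip_eigenvector_ordered_basis[OF two r0, of x2]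
  have "diagonal_mat 2 (matrix_wrt (*s) 2 ?e (diag_op t))"
    by (rule vec.diagonal_matI[OF axis_ordered_basis_3]) (rule diag_op_axis)
  moreover have "irreducible_tridiagonal_mat 2 (matrix_wrt (*s) 2 ?e ((*v) (bip x1 x2)))"
    by (rule vec.irreducible_tridiagonal_mat_2I[OF axis_ordered_basis_3, of _ 0 1 x1 0 1 x2 0])
      (use x in \<open>simp_all add: matrix_vector_mult_3 bip_def axis_def\<close>)
  moreover have "diagonal_mat 2 (matrix_wrt (*s) 2 ?v ((*v) (bip x1 x2)))"
  proof (rule vec.diagonal_matI[OF v])
    fix j :: nat assume "j \<le> 2"
    then have "j = 0 \<or> j = 1 \<or> j = 2" by auto
    then show "bip x1 x2 *v ?v j = (r * (1 - of_nat j)) *s ?v j"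
      by (intro bip_eigenvector_eigen) (auto simp flip: r simp: power2_eq_square power3_eq_cube)
  qed
  moreover have "irreducible_tridiagonal_mat 2 (matrix_wrt (*s) 2 ?v (diag_op t))"
  proof (rule vec.irreducible_tridiagonal_mat_2I[OF v, of _ "t 2" "t 3 - t 2" b "t 3 - 2 * b" b "t 3 - t 2" "t 2"])
    \<comment> \<open>In the first coordinate of the images of \<open>?v 0\<close> and
      \<open>?v 2\<close>, this is what makes the corner entries vanish.\<close>
    have eq': "(r\<^sup>2 - x2) * (t 1 - t 2) = x2 * (t 2 - t 3)"
      using eq by (simp add: x1)
    show "diag_op t (?v 0) = t 2 *s ?v 0 + (t 3 - t 2) *s ?v 1"
      and "diag_op t (?v 2) = (t 3 - t 2) *s ?v 1 + t 2 *s ?v 2"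
      using eq' by (simp_all add: vec_eq_iff forall_3 bip_eigenvector_def algebra_simps)
    show "diag_op t (?v 1) = b *s ?v 0 + (t 3 - 2 * b) *s ?v 1 + b *s ?v 2"
      using b by (simp add: vec_eq_iff forall_3 bip_eigenvector_def algebra_simps)
  qed (use ne \<open>b \<noteq> 0\<close> in auto)
  ultimately show ?thesis
    unfolding leonard_pair_def
    using v axis_ordered_basis_3 linear_diag_op matrix_vector_mul_linear_gen by blast
qed

theorem proposition11p2:
  fixes a0 a1 a2 x1 x2 t0 t1 t2 :: "'a::alg_closed_field"
    and A B As :: "'a ^ 3 ^ 3"
  assumes char: "CHAR('a) \<noteq> 2"
    and A: "A = vector [vector [a0, x1, 0], vector [1, a1, x2], vector [0, 1, a2]]"
    and B: "B = vector [vector [0, x1, 0], vector [1, 0, x2], vector [0, 1, 0]]"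
    and As: "As = vector [vector [t0, 0, 0], vector [0, t1, 0], vector [0, 0, t2]]"
    and leonard: "leonard_pair (*s) 2 ((*v) A) ((*v) As)"
  shows "(near_bipartite (*s) 2 ((*v) A) ((*v) As) \<longleftrightarrow> x1 / (t1 - t2) = x2 / (t0 - t1)) \<and>
    (near_bipartite (*s) 2 ((*v) A) ((*v) As) \<longrightarrow>
       is_bipartite_contraction (*s) 2 ((*v) A) ((*v) As) ((*v) B) ((*v) As))"
proof -
  have two: "(2 :: 'a) \<noteq> 0"
  proof
    assume "(2 :: 'a) = 0"
    then have "CHAR('a) dvd 2"
      using of_nat_eq_0_iff_char_dvd[of 2, where 'a = 'a] by simp
    moreover from this have "CHAR('a) \<le> 2"
      by (rule dvd_imp_le) simp
    moreover have "CHAR('a) \<noteq> 0"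
      using \<open>CHAR('a) dvd 2\<close> by (intro notI) simp
    ultimately show False
      using char CHAR_not_1'[where 'a = 'a] by linarith
  qed
  \<comment> \<open>The indices shift by one: \<open>t 1\<close>, \<open>t 2\<close>,
    \<open>t 3\<close> are \<open>t0\<close>, \<open>t1\<close>, \<open>t2\<close>.\<close>
  define t :: "3 \<Rightarrow> 'a" where "t i = vector [t0, t1, t2] $ i" for i
  have As': "(*v) As = diag_op t"
    by (rule ext) (simp add: matrix_vector_mult_3 As t_def)
  note leonard' = leonard[unfolded As']
  have t: "inj t" by (rule leonard_pair_diag_op_inj[OF leonard'])
  have ne: "t0 \<noteq> t1" "t1 \<noteq> t2"
    using injD[OF t, of 1 2] injD[OF t, of 2 3] by (auto simp: t_def)
  \<comment> \<open>The entries opposite to \<open>x1\<close> and \<open>x2\<close> are 1, so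
    neither can vanish by symmetry of the zero pattern.\<close>
  have x: "x1 \<noteq> 0" "x2 \<noteq> 0"
    using leonard_pair_diag_op_zero_pattern[OF leonard', of 1 2]
      leonard_pair_diag_op_zero_pattern[OF leonard', of 2 3] by (auto simp: A)
  have B': "B = bip x1 x2"
    by (simp add: B bip_def)
  have contraction: "(\<lambda>v. A *v v - flat_part (*s) ((*v) A) ((*v) As) v) = (*v) B"
    unfolding As' flat_part_diag_op[OF t]
    by (rule ext) (simp add: vec_eq_iff forall_3 matrix_vector_mult_def sum_3 A B)
  have "near_bipartite (*s) 2 ((*v) A) ((*v) As) \<longleftrightarrow> leonard_pair (*s) 2 ((*v) (bip x1 x2)) (diag_op t)"
    unfolding near_bipartite_def contraction using leonard by (simp add: As' B')
  also have "\<dots> \<longleftrightarrow> x1 * (t 1 - t 2) = x2 * (t 2 - t 3)"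
    using leonard_pair_bip_imp leonard_pair_bipI two t x by blast
  \<comment> \<open>Cross-multiplication; both denominators are nonzero as \<open>t\<close> is
    injective.\<close>
  also have "\<dots> \<longleftrightarrow> x1 / (t1 - t2) = x2 / (t0 - t1)"
    using ne by (simp add: t_def frac_eq_eq)
  finally show ?thesis
    by (simp add: is_bipartite_contraction_def contraction)
qed

end
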